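(* For any graph $G$ and any edge $e$ of $G$: $$P_{chr}(G)=P_{chr}(G\setminus e)-P_{chr}(G/e),$$ $$\lambda_{chr}(G)=\begin{cases}-\lambda_{chr}(G/e)&\text{if } e \text{ is a bridge},\\ \lambda_{chr}(G\setminus e)-\lambda_{chr}(G/e)&\text{otherwise}.\end{cases}$$
   Context: A graph is a pair $G=(V(G),E(G))$ with $V(G)$ a finite set and $E(G)$ a set of $2$-element subsets of $V(G)$; $cc(G)$ is the number of connected components of $G$. $P_{chr}(G)\in\mathbb{Q}[X]$ is the chromatic polynomial: for $k\geq1$, $P_{chr}(G)(k)$ is the number of maps $f:V(G)\to\{1,\ldots,k\}$ with $f(x)\neq f(y)$ for every edge $\{x,y\}$. For $G$ connected, $\lambda_{chr}(G)=\frac{dP_{chr}(G)}{dX}(0)$; for an arbitrary graph $G$ with connected components $G_1,\ldots,G_k$, $\lambda_{chr}(G)=\lambda_{chr}(G_1)\cdots\lambda_{chr}(G_k)$ (equal to $1$ for the empty graph). For an edge $e$ of $G$: $G/e$ is the simple graph obtained by identifying the two endpoints of $e$ into a single vertex, and deleting the loop and the multiple edges created (two distinct classes are adjacent if and only if some edge of $G$ joins them); $G\setminus e=(V(G),E(G)\setminus\{e\})$; $e$ is a bridge if $cc(G\setminus e)>cc(G)$. *)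

theory Defs
  imports
    "HOL-Computational_Algebra.Polynomial"
    "HOL-Library.FuncSet"
begin

type_synonym 'a graph = "'a set \<times> 'a set set"

abbreviation verts :: "'a graph \<Rightarrow> 'a set" where
  "verts G \<equiv> fst G"

abbreviation edges :: "'a graph \<Rightarrow> 'a set set" where
  "edges G \<equiv> snd G"

definition is_graph :: "'a graph \<Rightarrow> bool" where
  "is_graph G \<longleftrightarrow> finite (verts G) \<and> (\<forall>e\<in>edges G. e \<subseteq> verts G \<and> card e = 2)"

definition colourings :: "'a graph \<Rightarrow> nat \<Rightarrow> ('a \<Rightarrow> nat) set" where
  "colourings G k =
     {f \<in> verts G \<rightarrow>\<^sub>E {1..k}. \<forall>x y. {x, y} \<in> edges G \<longrightarrow> f x \<noteq> f y}"

definition chromatic_poly :: "'a graph \<Rightarrow> rat poly" where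
  "chromatic_poly G =
     (THE p. \<forall>k\<ge>1. poly p (of_nat k) = of_nat (card (colourings G k)))"

definition reachable :: "'a graph \<Rightarrow> ('a \<times> 'a) set" where
  "reachable G = {(x, y). {x, y} \<in> edges G}\<^sup>* \<inter> verts G \<times> verts G"

text \<open>The vertex sets of the connected components; the empty graph has none.\<close>

definition components :: "'a graph \<Rightarrow> 'a set set" where
  "components G = verts G // reachable G"

definition cc :: "'a graph \<Rightarrow> nat" where
  "cc G = card (components G)"

definition induced_subgraph :: "'a graph \<Rightarrow> 'a set \<Rightarrow> 'a graph" where
  "induced_subgraph G C = (C, {e \<in> edges G. e \<subseteq> C})"

text \<open>
  A connected graph is its own only component, so the product is then its one
  factor, the derivative at 0 (see \<open>lambda_chr_connected\<close>).
\<close>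

definition lambda_chr :: "'a graph \<Rightarrow> rat" where
  "lambda_chr G =
     (\<Prod>C\<in>components G. poly (pderiv (chromatic_poly (induced_subgraph G C))) 0)"

definition delete_edge :: "'a graph \<Rightarrow> 'a set \<Rightarrow> 'a graph" where
  "delete_edge G e = (verts G, edges G - {e})"

text \<open>
  The vertices of the contraction are the classes of the identification: the
  edge \<open>e\<close> itself, which is the class of its two endpoints, and the singletons
  of the other vertices.
\<close>

definition contract_verts :: "'a graph \<Rightarrow> 'a set \<Rightarrow> 'a set set" where
  "contract_verts G e = insert e {{v} | v. v \<in> verts G - e}"

definition contract_edge :: "'a graph \<Rightarrow> 'a set \<Rightarrow> 'a set graph" where
  "contract_edge G e =
     (contract_verts G e,
      {{A, B} | A B. A \<in> contract_verts G e \<and> B \<in> contract_verts G e \<and> A \<noteq> B \<and>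
                     (\<exists>x\<in>A. \<exists>y\<in>B. {x, y} \<in> edges G)})"

definition bridge :: "'a graph \<Rightarrow> 'a set \<Rightarrow> bool" where
  "bridge G e \<longleftrightarrow> cc (delete_edge G e) > cc G"

lemma lambda_chr_connected:
  assumes "is_graph G" and "cc G = 1"
  shows "lambda_chr G = poly (pderiv (chromatic_poly G)) 0"
proof -
  obtain C where C: "components G = {C}"
    using assms(2) unfolding cc_def by (auto simp: card_1_singleton_iff)
  have "\<Union> (components G) = verts G"
    by (auto simp: components_def reachable_def quotient_def Image_def)
  then have "C = verts G"
    using C by simp
  moreover have "{e \<in> edges G. e \<subseteq> verts G} = edges G"
    using assms(1) by (auto simp: is_graph_def)
  ultimately have "induced_subgraph G C = G"
    by (simp add: induced_subgraph_def)
  then show ?thesis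
    by (simp add: lambda_chr_def C)
qed

end

theory Submission imports Defs begin

text \<open>
  The polynomial identity is a count. A colouring of $G \setminus e$ gives the endpoints of
  \<open>e\<close> different colours, and then it is a colouring of \<open>G\<close>, or equal colours, and then it
  factors through the contraction as a colouring of $G/e$
  (\<open>chromatic_poly_deletion_contraction\<close>).

  The invariant becomes tractable once it is read off as a single coefficient. The chromatic
  polynomial is the product of those of the components, and each of these vanishes at 0
  because a nonempty set has no map into the empty set. Hence $X^{cc(G)}$ divides
  $P_{chr}(G)$, and the coefficient of $X^{cc(G)}$ is the product of the linear coefficients
  of the factors, which is $\lambda_{chr}(G)$ (\<open>lambda_chr_eq_coeff\<close>). It remains to compare
  the coefficients of $X^{cc(G)}$ in the polynomial identity. Contraction keeps the number
  of components, so $G/e$ contributes its invariant. If \<open>e\<close> is not a bridge, so does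
  $G \setminus e$; if \<open>e\<close> is a bridge, then $X^{cc(G)+1}$ divides
  $P_{chr}(G \setminus e)$, which contributes 0.

  Both the numbers of components and the existence of the polynomial are handled by counting
  locally constant maps: there are $k^{cc(G)}$ of them with values in $\{1,\ldots,k\}$
  (\<open>card_locally_constant\<close>). So \<open>cc\<close> can be compared between graphs on different vertex
  types by counting maps into two values, and the count of colourings is an alternating sum of
  such powers of \<open>k\<close>, hence a polynomial in \<open>k\<close>.
\<close>

section \<open>Counting maps through bijections\<close>

text \<open>
  The universal property of a quotient map \<open>q\<close>: maps on the quotient are the maps on \<open>A\<close> that
  are constant on the fibres. It serves for the quotient by reachability and for the
  contraction of an edge.
\<close>

lemma bij_betw_pullback:
  assumes q: "q ` A = B"
  shows "bij_betw (\<lambda>g. restrict (\<lambda>x. g (q x)) A) (B \<rightarrow>\<^sub>E K)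
           {f \<in> A \<rightarrow>\<^sub>E K. \<forall>x\<in>A. \<forall>y\<in>A. q x = q y \<longrightarrow> f x = f y}"
proof (rule bij_betw_byWitness[where f' = "\<lambda>f. restrict (\<lambda>b. f (inv_into A q b)) B"])
  have inv: "inv_into A q b \<in> A" "q (inv_into A q b) = b" if "b \<in> B" for b
    using that q by (auto intro: inv_into_into f_inv_into_f)
  have im: "q x \<in> B" if "x \<in> A" for x
    using that q by auto
  show "\<forall>g\<in>B \<rightarrow>\<^sub>E K. restrict (\<lambda>b. restrict (\<lambda>x. g (q x)) A (inv_into A q b)) B = g"
  proof (intro ballI ext, goal_cases)
    case (1 g b)
    then show ?case
      using inv[of b] PiE_arb[OF 1, of b] by (cases "b \<in> B") simp_all
  qed
  show "\<forall>f\<in>{f \<in> A \<rightarrow>\<^sub>E K. \<forall>x\<in>A. \<forall>y\<in>A. q x = q y \<longrightarrow> f x = f y}.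
          restrict (\<lambda>x. restrict (\<lambda>b. f (inv_into A q b)) B (q x)) A = f"
  proof (intro ballI ext, goal_cases)
    case (1 f x)
    show ?case
    proof (cases "x \<in> A")
      case True
      then have "f (inv_into A q (q x)) = f x"
        using 1 inv[OF im[OF True]] by blast
      then show ?thesis
        using True im by simp
    next
      case False
      have "f x = undefined"
        using 1 False by (auto intro: PiE_arb)
      then show ?thesis
        using False by simp
    qed
  qed
  show "(\<lambda>g. restrict (\<lambda>x. g (q x)) A) ` (B \<rightarrow>\<^sub>E K)
          \<subseteq> {f \<in> A \<rightarrow>\<^sub>E K. \<forall>x\<in>A. \<forall>y\<in>A. q x = q y \<longrightarrow> f x = f y}"
    using im by (intro image_subsetI) (simp add: PiE_iff extensional_def)
  show "(\<lambda>f. restrict (\<lambda>b. f (inv_into A q b)) B)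
          ` {f \<in> A \<rightarrow>\<^sub>E K. \<forall>x\<in>A. \<forall>y\<in>A. q x = q y \<longrightarrow> f x = f y} \<subseteq> (B \<rightarrow>\<^sub>E K)"
    using inv by (intro image_subsetI) (simp add: PiE_iff extensional_def)
qed

lemma card_Collect_bij_betw:
  assumes "bij_betw \<phi> X Y" and "\<And>x. x \<in> X \<Longrightarrow> P x \<longleftrightarrow> Q (\<phi> x)"
  shows "card {x \<in> X. P x} = card {y \<in> Y. Q y}"
proof -
  have "\<phi> ` {x \<in> X. P x} = {y \<in> Y. Q y}"
    using assms by (auto simp: bij_betw_def)
  moreover have "inj_on \<phi> {x \<in> X. P x}"
    using assms(1) by (auto simp: bij_betw_def intro: inj_on_subset)
  ultimately show ?thesis
    by (metis card_image)
qed

section \<open>Components and locally constant maps\<close>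

lemma edge_in_verts:
  assumes "is_graph G" and "{x, y} \<in> edges G"
  shows "x \<in> verts G" "y \<in> verts G" "x \<noteq> y"
  using assms by (auto simp: is_graph_def)

text \<open>
  An edge is an unordered pair, so the condition on the new edge reads both ways round; the
  symmetry of \<open>R\<close> merges the two.
\<close>

lemma all_edges_insert:
  assumes "R a b \<longleftrightarrow> R b a"
  shows "(\<forall>x y. {x, y} \<in> insert {a, b} E \<longrightarrow> R x y) \<longleftrightarrow>
    R a b \<and> (\<forall>x y. {x, y} \<in> E \<longrightarrow> R x y)"
  using assms by (metis doubleton_eq_iff insert_iff)

lemma equiv_reachable: "equiv (verts G) (reachable G)"
proof (rule equivI)
  show "refl_on (verts G) (reachable G)"
    by (auto simp: reachable_def refl_on_def)
  have "sym ({(x, y). {x, y} \<in> edges G}\<^sup>*)"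
    by (intro sym_rtrancl) (auto simp: sym_def insert_commute)
  then show "sym (reachable G)"
    by (auto simp: reachable_def sym_def)
  show "trans (reachable G)"
    by (auto simp: reachable_def trans_def intro: rtrancl_trans)
  show "reachable G \<subseteq> verts G \<times> verts G"
    by (auto simp: reachable_def)
qed

lemma edge_reachable:
  assumes "is_graph G" and "{x, y} \<in> edges G"
  shows "(x, y) \<in> reachable G"
  using edge_in_verts[OF assms] assms(2) by (auto simp: reachable_def)

lemma locally_constant_iff:
  assumes "is_graph G"
  shows "(\<forall>x y. {x, y} \<in> edges G \<longrightarrow> f x = f y) \<longleftrightarrow> (\<forall>(x, y)\<in>reachable G. f x = f y)"
proof
  assume edge: "\<forall>x y. {x, y} \<in> edges G \<longrightarrow> f x = f y"
  have "f x = f y" if "(x, y) \<in> {(x, y). {x, y} \<in> edges G}\<^sup>*" for x y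
    using that by (induction rule: rtrancl_induct) (use edge in auto)
  then show "\<forall>(x, y)\<in>reachable G. f x = f y"
    by (auto simp: reachable_def)
qed (use edge_reachable[OF assms] in blast)

definition locally_constant :: "'a graph \<Rightarrow> nat \<Rightarrow> ('a \<Rightarrow> nat) set" where
  "locally_constant G k =
     {f \<in> verts G \<rightarrow>\<^sub>E {1..k}. \<forall>x y. {x, y} \<in> edges G \<longrightarrow> f x = f y}"

lemma finite_components: "is_graph G \<Longrightarrow> finite (components G)"
  unfolding components_def is_graph_def
  by (intro finite_quotient equiv_type[OF equiv_reachable]) simp

text \<open>
  A locally constant map is a choice of one value for each component. This holds for
  \<open>k = 0\<close> too, where a map exists only on the empty graph.
\<close>

lemma card_locally_constant:
  assumes G: "is_graph G"
  shows "card (locally_constant G k) = k ^ cc G"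
proof -
  let ?q = "\<lambda>x. reachable G `` {x}"
  have "?q ` verts G = components G"
    by (auto simp: components_def quotient_def)
  note bij = bij_betw_pullback[OF this, of "{1..k}"]
  have "(\<forall>x\<in>verts G. \<forall>y\<in>verts G. ?q x = ?q y \<longrightarrow> f x = f y) \<longleftrightarrow>
      (\<forall>(x, y)\<in>reachable G. f x = f y)" for f :: "'a \<Rightarrow> nat"
    using equiv_class_eq_iff[OF equiv_reachable[of G]] by fast
  then have "{f \<in> verts G \<rightarrow>\<^sub>E {1..k}. \<forall>x\<in>verts G. \<forall>y\<in>verts G. ?q x = ?q y \<longrightarrow> f x = f y}
          = locally_constant G k"
    unfolding locally_constant_def locally_constant_iff[OF G] by simp
  then have "card (locally_constant G k) = card (components G \<rightarrow>\<^sub>E {1..k})"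
    using bij_betw_same_card[OF bij] by simp
  then show ?thesis
    by (simp add: card_PiE finite_components[OF G] cc_def)
qed

section \<open>The chromatic polynomial\<close>

lemma finite_maps_interval: "is_graph G \<Longrightarrow> finite (verts G \<rightarrow>\<^sub>E {1..k::nat})"
  by (intro finite_PiE) (auto simp: is_graph_def)

text \<open>
  Edges in \<open>E\<close> demand different values at their endpoints, edges in \<open>F\<close> equal ones. The maps
  that satisfy \<open>E\<close> and break the inequality at one further edge are those that satisfy an
  additional equality there, so an edge moves from \<open>E\<close> to \<open>F\<close>. This is deletion and
  contraction with the vertex set left fixed; an induction through actual contractions would
  change the vertex type at each step. With \<open>E\<close> exhausted, the count is a power of \<open>k\<close>.
\<close>

lemma ex_poly_card_mixed:
  assumes "finite E" and "is_graph (V, E)" and "is_graph (V, F)"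
  shows "\<exists>p :: rat poly. \<forall>k. poly p (of_nat k) =
           of_nat (card {f \<in> locally_constant (V, F) k. \<forall>x y. {x, y} \<in> E \<longrightarrow> f x \<noteq> f y})"
  using assms
proof (induction E arbitrary: F rule: finite_induct)
  case empty
  have "poly (monom 1 (cc (V, F))) (of_nat k) = (of_nat (card (locally_constant (V, F) k)) :: rat)" for k
    by (simp add: card_locally_constant[OF empty(2)] poly_monom)
  then show ?case
    by auto
next
  case (insert e E)
  let ?N = "\<lambda>E F k. {f \<in> locally_constant (V, F) k. \<forall>x y. {x, y} \<in> E \<longrightarrow> f x \<noteq> f y}"
  obtain a b where e: "e = {a, b}"
    using insert.prems(1) by (auto simp: is_graph_def card_2_iff)
  have gE: "is_graph (V, E)" and gF: "is_graph (V, insert e F)"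
    using insert.prems by (auto simp: is_graph_def)
  obtain p where p: "poly p (of_nat k) = (of_nat (card (?N E F k)) :: rat)" for k
    using insert.IH[OF gE insert.prems(2)] by blast
  obtain p' where p': "poly p' (of_nat k) = (of_nat (card (?N E (insert e F) k)) :: rat)" for k
    using insert.IH[OF gE gF] by blast
  have "poly (p - p') (of_nat k) = (of_nat (card (?N (insert e E) F k)) :: rat)" for k
  proof -
    have fin: "finite (?N E F k)"
      using finite_maps_interval[OF insert.prems(2), of k]
      by (auto simp: locally_constant_def intro: finite_subset)
    have sub: "?N E (insert e F) k \<subseteq> ?N E F k"
      by (rule Collect_mono) (simp add: locally_constant_def)
    have diff: "?N (insert e E) F k = ?N E F k - ?N E (insert e F) k"
    proof (intro set_eqI)
      fix f :: "'a \<Rightarrow> nat"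
      have "(\<forall>x y. {x, y} \<in> insert e E \<longrightarrow> f x \<noteq> f y) \<longleftrightarrow>
          f a \<noteq> f b \<and> (\<forall>x y. {x, y} \<in> E \<longrightarrow> f x \<noteq> f y)"
        unfolding e by (rule all_edges_insert) auto
      moreover have "(\<forall>x y. {x, y} \<in> insert e F \<longrightarrow> f x = f y) \<longleftrightarrow>
          f a = f b \<and> (\<forall>x y. {x, y} \<in> F \<longrightarrow> f x = f y)"
        unfolding e by (rule all_edges_insert) auto
      ultimately show "f \<in> ?N (insert e E) F k \<longleftrightarrow> f \<in> ?N E F k - ?N E (insert e F) k"
        unfolding locally_constant_def mem_Collect_eq Diff_iff fst_conv snd_conv by argo
    qed
    show ?thesis
      unfolding diff poly_diff p p' card_Diff_subset[OF finite_subset[OF sub fin] sub]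
      by (rule of_nat_diff[OF card_mono[OF fin sub], symmetric])
  qed
  then show ?case
    by blast
qed

lemma poly_eqI_positive_nats:
  fixes p q :: "rat poly"
  assumes "\<And>k. k \<ge> 1 \<Longrightarrow> poly p (of_nat k) = poly q (of_nat k)"
  shows "p = q"
proof (rule ccontr)
  assume "p \<noteq> q"
  then have "finite {x. poly (p - q) x = 0}"
    by (intro poly_roots_finite) simp
  moreover have "of_nat ` {1..} \<subseteq> {x. poly (p - q) x = 0}"
    using assms by auto
  ultimately have "finite ((of_nat :: nat \<Rightarrow> rat) ` {1..})"
    by (rule finite_subset[rotated])
  then have "finite {1::nat..}"
    by (rule finite_imageD) (auto simp: inj_on_def)
  then show False
    by (simp add: infinite_Ici)
qed

lemma chromatic_poly_eqI:
  assumes "\<And>k. k \<ge> 1 \<Longrightarrow> poly p (of_nat k) = of_nat (card (colourings G k))"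
  shows "chromatic_poly G = p"
  unfolding chromatic_poly_def
  using assms by (intro the_equality) (auto intro!: poly_eqI_positive_nats)

text \<open>
  The chromatic polynomial is pinned down by its values at $k \geq 1$, but the count is
  polynomial from \<open>k = 0\<close> on. The value at 0 is what makes the constant term vanish.
\<close>

lemma poly_chromatic_poly:
  assumes G: "is_graph G"
  shows "poly (chromatic_poly G) (of_nat k) = of_nat (card (colourings G k))"
proof -
  obtain V E where VE: "G = (V, E)"
    by (cases G)
  have "finite E"
    using G by (auto simp: VE is_graph_def intro!: finite_subset[of E "Pow V"])
  moreover have "is_graph (V, {})"
    using G by (auto simp: VE is_graph_def)
  ultimately obtain p :: "rat poly" where "\<forall>k. poly p (of_nat k) =
      of_nat (card {f \<in> locally_constant (V, {}) k. \<forall>x y. {x, y} \<in> E \<longrightarrow> f x \<noteq> f y})"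
    using ex_poly_card_mixed[of E V "{}"] G VE by blast
  then have p: "\<forall>k. poly p (of_nat k) = of_nat (card (colourings G k))"
    by (simp add: locally_constant_def colourings_def VE)
  then have "chromatic_poly G = p"
    by (intro chromatic_poly_eqI) auto
  then show ?thesis
    using p by simp
qed

lemma chromatic_poly_at_0:
  assumes "is_graph G" and "verts G \<noteq> {}"
  shows "poly (chromatic_poly G) 0 = 0"
proof -
  have "colourings G 0 = {}"
    using assms(2) by (auto simp: colourings_def PiE_iff)
  then show ?thesis
    using poly_chromatic_poly[OF assms(1), of 0] by simp
qed

section \<open>The invariant as a coefficient\<close>

lemma is_graph_induced_subgraph:
  "is_graph G \<Longrightarrow> C \<subseteq> verts G \<Longrightarrow> is_graph (induced_subgraph G C)"
  by (auto simp: is_graph_def induced_subgraph_def intro: finite_subset)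

lemma component_subset: "C \<in> components G \<Longrightarrow> C \<subseteq> verts G"
  unfolding components_def by (rule in_quotient_imp_subset[OF equiv_reachable])

lemma component_nonempty: "C \<in> components G \<Longrightarrow> C \<noteq> {}"
  unfolding components_def by (rule in_quotient_imp_non_empty[OF equiv_reachable])

lemma component_of_member:
  "C \<in> components G \<Longrightarrow> x \<in> C \<Longrightarrow> reachable G `` {x} = C"
  unfolding components_def
  by (metis Image_singleton_iff equiv_class_eq_iff equiv_reachable quotientE)

lemma component_self:
  "x \<in> verts G \<Longrightarrow> x \<in> reachable G `` {x} \<and> reachable G `` {x} \<in> components G"
  unfolding components_def by (intro conjI equiv_class_self[OF equiv_reachable] quotientI)

text \<open>
  No edge joins two components, so a colouring is an independent choice of a colouring on each
  of them.
\<close>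

lemma card_colourings_components:
  assumes G: "is_graph G"
  shows "card (colourings G k) = (\<Prod>C\<in>components G. card (colourings (induced_subgraph G C) k))"
proof -
  let ?c = "\<lambda>x. reachable G `` {x}"
  let ?P = "PiE (components G) (\<lambda>C. colourings (induced_subgraph G C) k)"
  let ?split = "\<lambda>f. \<lambda>C\<in>components G. restrict f C"
  let ?glue = "\<lambda>h. \<lambda>x\<in>verts G. h (?c x) x"
  have col: "colourings (induced_subgraph G C) k =
      {f \<in> C \<rightarrow>\<^sub>E {1..k}. \<forall>x y. {x, y} \<in> edges G \<and> x \<in> C \<and> y \<in> C \<longrightarrow> f x \<noteq> f y}" for C
    by (auto simp: colourings_def induced_subgraph_def)
  have "bij_betw ?split (colourings G k) ?P"
  proof (rule bij_betw_byWitness[where f' = ?glue])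
    show "\<forall>f\<in>colourings G k. ?glue (?split f) = f"
    proof (intro ballI ext, goal_cases)
      case (1 f x)
      then have "x \<notin> verts G \<Longrightarrow> f x = undefined"
        by (auto simp: colourings_def intro: PiE_arb)
      then show ?case
        using component_self[of x G] by auto
    qed
    show "\<forall>h\<in>?P. ?split (?glue h) = h"
    proof (intro ballI ext, goal_cases)
      case (1 h C x)
      show ?case
      proof (cases "C \<in> components G")
        case True
        then have "h C \<in> C \<rightarrow>\<^sub>E {1..k}"
          using PiE_mem[OF 1 True] unfolding col by blast
        then have "x \<notin> C \<Longrightarrow> h C x = undefined"
          by (rule PiE_arb)
        moreover have "x \<in> C \<Longrightarrow> x \<in> verts G"
          using component_subset[OF True] by blast
        ultimately show ?thesis
          using True component_of_member[OF True, of x] by (cases "x \<in> C") auto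
      next
        case False
        then show ?thesis
          using PiE_arb[OF 1 False] by simp
      qed
    qed
    show "?split ` colourings G k \<subseteq> ?P"
    proof (intro image_subsetI PiE_I, goal_cases)
      case (1 f C)
      then show ?case
        using component_subset[OF 1(2)] by (auto simp: col) (auto simp: colourings_def)
    qed auto
    show "?glue ` ?P \<subseteq> colourings G k"
    proof (intro image_subsetI)
      fix h assume h: "h \<in> ?P"
      have hc: "h (?c x) \<in> colourings (induced_subgraph G (?c x)) k" if "x \<in> verts G" for x
        using PiE_mem[OF h] component_self[OF that] by blast
      have "h (?c x) x \<in> {1..k}" if "x \<in> verts G" for x
        using hc[OF that] component_self[OF that] unfolding col by blast
      moreover have "?glue h x \<noteq> ?glue h y" if xy: "{x, y} \<in> edges G" for x y
      proof -
        have V: "x \<in> verts G" "y \<in> verts G"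
          using edge_in_verts[OF G xy] by auto
        have c: "?c x = ?c y"
          using equiv_class_eq[OF equiv_reachable edge_reachable[OF G xy]] .
        have "y \<in> ?c x"
          using component_self[OF V(2)] unfolding c by blast
        then have "h (?c x) x \<noteq> h (?c x) y"
          using hc[OF V(1)] xy component_self[OF V(1)] unfolding col by blast
        then show ?thesis
          using V c by simp
      qed
      ultimately show "?glue h \<in> colourings G k"
        by (auto simp: colourings_def)
    qed
  qed
  then have "card (colourings G k) = card ?P"
    by (rule bij_betw_same_card)
  then show ?thesis
    by (simp add: card_PiE finite_components[OF G])
qed

lemma chromatic_poly_components:
  assumes G: "is_graph G"
  shows "chromatic_poly G = (\<Prod>C\<in>components G. chromatic_poly (induced_subgraph G C))"
proof (rule chromatic_poly_eqI)
  fix k :: nat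
  show "poly (\<Prod>C\<in>components G. chromatic_poly (induced_subgraph G C)) (of_nat k)
          = of_nat (card (colourings G k))"
    by (simp add: poly_prod poly_chromatic_poly is_graph_induced_subgraph[OF G]
        component_subset card_colourings_components[OF G])
qed

text \<open>Each factor is \<open>X\<close> times a polynomial whose constant term is the linear coefficient.\<close>

lemma coeff_prod_no_constant_term:
  fixes p :: "'i \<Rightarrow> 'r :: comm_ring_1 poly"
  assumes "finite A" and "\<And>i. i \<in> A \<Longrightarrow> coeff (p i) 0 = 0"
  shows "coeff (prod p A) (card A) = (\<Prod>i\<in>A. coeff (p i) 1)"
    and "n < card A \<Longrightarrow> coeff (prod p A) n = 0"
proof -
  \<comment> \<open>\<open>poly_shift 1\<close> is the division by \<open>X\<close>, exact here since the constant term is 0.\<close>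
  have "p i = monom 1 1 * poly_shift 1 (p i)" if "i \<in> A" for i
    using assms(2)[OF that] by (intro poly_eqI) (auto simp: coeff_monom_mult coeff_poly_shift Suc_le_eq)
  then have "prod p A = (\<Prod>i\<in>A. monom 1 1 * poly_shift 1 (p i))"
    by (intro prod.cong) auto
  also have "\<dots> = monom 1 (card A) * (\<Prod>i\<in>A. poly_shift 1 (p i))"
    by (simp add: prod.distrib monom_power)
  finally have *: "prod p A = monom 1 (card A) * (\<Prod>i\<in>A. poly_shift 1 (p i))" .
  show "coeff (prod p A) (card A) = (\<Prod>i\<in>A. coeff (p i) 1)"
    by (simp add: * coeff_monom_mult poly_0_coeff_0[symmetric] poly_prod)
      (simp add: poly_0_coeff_0 coeff_poly_shift)
  show "n < card A \<Longrightarrow> coeff (prod p A) n = 0"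
    by (simp add: * coeff_monom_mult)
qed

lemma
  assumes G: "is_graph G"
  shows lambda_chr_eq_coeff: "lambda_chr G = coeff (chromatic_poly G) (cc G)"
    and coeff_chromatic_poly_below: "n < cc G \<Longrightarrow> coeff (chromatic_poly G) n = 0"
proof -
  let ?p = "\<lambda>C. chromatic_poly (induced_subgraph G C)"
  have "coeff (?p C) 0 = 0" if "C \<in> components G" for C
    using chromatic_poly_at_0[OF is_graph_induced_subgraph[OF G component_subset[OF that]]]
      component_nonempty[OF that]
    by (simp add: induced_subgraph_def poly_0_coeff_0)
  note coeff = coeff_prod_no_constant_term[of "components G" ?p, OF finite_components[OF G] this]
  show "lambda_chr G = coeff (chromatic_poly G) (cc G)"
    using coeff(1)
    by (simp add: lambda_chr_def chromatic_poly_components[OF G] cc_def poly_0_coeff_0 coeff_pderiv)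
  show "n < cc G \<Longrightarrow> coeff (chromatic_poly G) n = 0"
    using coeff(2) by (simp add: chromatic_poly_components[OF G] cc_def)
qed

section \<open>Deletion and contraction\<close>

lemma is_graph_delete_edge: "is_graph G \<Longrightarrow> is_graph (delete_edge G e)"
  by (auto simp: is_graph_def delete_edge_def)

lemma is_graph_contract_edge:
  assumes "is_graph G"
  shows "is_graph (contract_edge G e)"
proof -
  have "finite (contract_verts G e)"
    using assms by (simp add: is_graph_def contract_verts_def)
  moreover have "d \<subseteq> contract_verts G e \<and> card d = 2" if "d \<in> edges (contract_edge G e)" for d
  proof -
    obtain A B where "d = {A, B}" "A \<in> contract_verts G e" "B \<in> contract_verts G e" "A \<noteq> B"
      using \<open>d \<in> edges (contract_edge G e)\<close> unfolding contract_edge_def snd_conv by blast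
    then show ?thesis
      by simp
  qed
  ultimately show ?thesis
    unfolding is_graph_def by (simp add: contract_edge_def)
qed

definition contract_class :: "'a set \<Rightarrow> 'a \<Rightarrow> 'a set" where
  "contract_class e v = (if v \<in> e then e else {v})"

lemma contract_class_eq_iff:
  assumes "card e = 2"
  shows "contract_class e x = contract_class e y \<longleftrightarrow> x = y \<or> (x \<in> e \<and> y \<in> e)"
  using assms by (auto simp: contract_class_def)

lemma image_contract_class:
  assumes "is_graph G" and "e \<in> edges G"
  shows "contract_class e ` verts G = contract_verts G e"
proof -
  have "e \<subseteq> verts G" "e \<noteq> {}"
    using assms by (auto simp: is_graph_def)
  then show ?thesis
    by (fastforce simp: contract_class_def contract_verts_def)
qed

text \<open>
  The edges of the contraction are the images of the edges other than \<open>e\<close>: in a graph without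
  multiple edges, \<open>e\<close> is the only edge whose endpoints are identified, that is, the only one
  that becomes a loop.
\<close>

lemma edge_contract_edge_iff:
  assumes G: "is_graph G" and e: "e \<in> edges G"
  shows "{A, B} \<in> edges (contract_edge G e) \<longleftrightarrow>
    (\<exists>x y. {x, y} \<in> edges (delete_edge G e) \<and> A = contract_class e x \<and> B = contract_class e y)"
    (is "_ \<longleftrightarrow> ?R A B")
proof -
  let ?c = "contract_class e"
  have card_e: "card e = 2"
    using G e by (auto simp: is_graph_def)
  have class_of: "A = ?c x" if "A \<in> contract_verts G e" "x \<in> A" for A x
    using that by (auto simp: contract_verts_def contract_class_def)
  have mem_class: "x \<in> ?c x" for x
    by (auto simp: contract_class_def)
  have sym: "?R A B \<Longrightarrow> ?R B A" for A B
    by (metis insert_commute)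
  have fwd: "?R A B" if "A \<in> contract_verts G e" "B \<in> contract_verts G e" "A \<noteq> B"
      "x \<in> A" "y \<in> B" "{x, y} \<in> edges G" for A B x y
  proof -
    have "{x, y} \<noteq> e"
      using that class_of[of A x] class_of[of B y] by (auto simp: contract_class_def)
    then show ?thesis
      using that class_of[of A x] class_of[of B y] by (auto simp: delete_edge_def)
  qed
  show ?thesis
  proof
    assume "{A, B} \<in> edges (contract_edge G e)"
    then obtain A' B' where AB: "{A, B} = {A', B'}" and "A' \<in> contract_verts G e"
      "B' \<in> contract_verts G e" "A' \<noteq> B'" "\<exists>x\<in>A'. \<exists>y\<in>B'. {x, y} \<in> edges G"
      unfolding contract_edge_def snd_conv by blast
    then have "?R A' B'"
      using fwd by blast
    then show "?R A B"
      using AB sym[of A' B'] unfolding doubleton_eq_iff by blast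
  next
    assume "?R A B"
    then obtain x y where xy: "{x, y} \<in> edges G" "{x, y} \<noteq> e" "A = ?c x" "B = ?c y"
      by (auto simp: delete_edge_def)
    have V: "x \<in> verts G" "y \<in> verts G" "x \<noteq> y"
      using edge_in_verts[OF G xy(1)] by auto
    have "\<not> (x \<in> e \<and> y \<in> e)"
      using xy(2) V(3) card_e by (auto simp: card_2_iff)
    then have "A \<noteq> B"
      using V(3) contract_class_eq_iff[OF card_e] xy by auto
    moreover have "A \<in> contract_verts G e" "B \<in> contract_verts G e"
      using image_contract_class[OF G e] V xy by auto
    ultimately show "{A, B} \<in> edges (contract_edge G e)"
      using mem_class[of x] mem_class[of y] xy unfolding contract_edge_def by auto
  qed
qed

text \<open>
  Stated for any edge condition \<open>R\<close>, because it is used twice: with inequality it counts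
  colourings, with equality it counts locally constant maps and so components.
\<close>

lemma card_maps_contract_edge:
  assumes G: "is_graph G" and e: "{a, b} \<in> edges G"
  shows "card {g \<in> verts (contract_edge G {a, b}) \<rightarrow>\<^sub>E K.
            \<forall>A B. {A, B} \<in> edges (contract_edge G {a, b}) \<longrightarrow> R (g A) (g B)}
       = card {f \<in> verts G \<rightarrow>\<^sub>E K. f a = f b \<and>
            (\<forall>x y. {x, y} \<in> edges (delete_edge G {a, b}) \<longrightarrow> R (f x) (f y))}"
proof -
  let ?e = "{a, b}"
  let ?c = "contract_class ?e"
  have card_e: "card ?e = 2" and ab: "a \<in> verts G" "b \<in> verts G"
    using G e by (auto simp: is_graph_def)
  have "{f \<in> verts G \<rightarrow>\<^sub>E K. \<forall>x\<in>verts G. \<forall>y\<in>verts G. ?c x = ?c y \<longrightarrow> f x = f y}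
      = {f \<in> verts G \<rightarrow>\<^sub>E K. f a = f b}"
    unfolding contract_class_eq_iff[OF card_e] using ab by auto
  with bij_betw_pullback[OF image_contract_class[OF G e], of K]
  have bij: "bij_betw (\<lambda>g. restrict (\<lambda>x. g (?c x)) (verts G))
      (verts (contract_edge G ?e) \<rightarrow>\<^sub>E K) {f \<in> verts G \<rightarrow>\<^sub>E K. f a = f b}"
    by (simp add: contract_edge_def)
  have V: "x \<in> verts G \<and> y \<in> verts G" if "{x, y} \<in> edges (delete_edge G ?e)" for x y
    using edge_in_verts[OF G, of x y] that by (auto simp: delete_edge_def)
  have "(\<forall>A B. {A, B} \<in> edges (contract_edge G ?e) \<longrightarrow> R (g A) (g B)) \<longleftrightarrow>
      (\<forall>x y. {x, y} \<in> edges (delete_edge G ?e) \<longrightarrow>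
        R (restrict (\<lambda>x. g (?c x)) (verts G) x) (restrict (\<lambda>x. g (?c x)) (verts G) y))" for g
    unfolding edge_contract_edge_iff[OF G e] using V by (simp add: restrict_def) blast
  from card_Collect_bij_betw[where Q = "\<lambda>f. \<forall>x y. {x, y} \<in> edges (delete_edge G ?e) \<longrightarrow>
      R (f x) (f y)", OF bij this]
  show ?thesis
    by (simp add: conj_assoc)
qed

lemma chromatic_poly_deletion_contraction:
  assumes G: "is_graph G" and e: "e \<in> edges G"
  shows "chromatic_poly G = chromatic_poly (delete_edge G e) - chromatic_poly (contract_edge G e)"
proof (rule chromatic_poly_eqI)
  fix k :: nat
  obtain a b where ab: "e = {a, b}"
    using G e by (auto simp: is_graph_def card_2_iff)
  let ?S = "{f \<in> colourings (delete_edge G e) k. f a = f b}"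
  have fin: "finite (colourings (delete_edge G e) k)"
    using finite_maps_interval[OF is_graph_delete_edge[OF G], of e k]
    by (auto simp: colourings_def intro: finite_subset)
  have "card (colourings (contract_edge G e) k) = card ?S"
    using card_maps_contract_edge[OF G e[unfolded ab], of "{1..k}" "(\<noteq>)"]
    by (simp add: colourings_def ab delete_edge_def conj_ac)
  moreover have "edges G = insert {a, b} (edges (delete_edge G e))"
    using e by (auto simp: delete_edge_def ab)
  then have "(\<forall>x y. {x, y} \<in> edges G \<longrightarrow> f x \<noteq> f y) \<longleftrightarrow>
      f a \<noteq> f b \<and> (\<forall>x y. {x, y} \<in> edges (delete_edge G e) \<longrightarrow> f x \<noteq> f y)" for f :: "'a \<Rightarrow> nat"
    by (simp only:) (rule all_edges_insert, auto)
  then have "colourings G k = colourings (delete_edge G e) k - ?S"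
    unfolding colourings_def by (auto simp: delete_edge_def)
  then have "card (colourings G k) = card (colourings (delete_edge G e) k) - card ?S"
    using fin by (simp add: card_Diff_subset)
  moreover have "card ?S \<le> card (colourings (delete_edge G e) k)"
    using fin by (intro card_mono) auto
  ultimately show "poly (chromatic_poly (delete_edge G e) - chromatic_poly (contract_edge G e))
      (of_nat k) = of_nat (card (colourings G k))"
    by (simp add: poly_chromatic_poly is_graph_delete_edge[OF G] is_graph_contract_edge[OF G]
        of_nat_diff)
qed

text \<open>
  Pulling back along the contraction identifies the locally constant maps of the two graphs.
  Two values are the fewest for which the number of maps determines the exponent \<open>cc\<close>.
\<close>

lemma cc_contract_edge:
  assumes G: "is_graph G" and e: "e \<in> edges G"
  shows "cc (contract_edge G e) = cc G"
proof -
  obtain a b where ab: "e = {a, b}"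
    using G e by (auto simp: is_graph_def card_2_iff)
  have "edges G = insert {a, b} (edges (delete_edge G {a, b}))"
    using e by (auto simp: delete_edge_def ab)
  then have "(\<forall>x y. {x, y} \<in> edges G \<longrightarrow> f x = f y) \<longleftrightarrow>
      f a = f b \<and> (\<forall>x y. {x, y} \<in> edges (delete_edge G {a, b}) \<longrightarrow> f x = f y)" for f :: "'a \<Rightarrow> nat"
    by (simp only:) (rule all_edges_insert, auto)
  then have "locally_constant G 2 = {f \<in> verts G \<rightarrow>\<^sub>E {1..2}. f a = f b \<and>
      (\<forall>x y. {x, y} \<in> edges (delete_edge G {a, b}) \<longrightarrow> f x = f y)}"
    by (simp add: locally_constant_def)
  then have "card (locally_constant (contract_edge G e) 2) = card (locally_constant G 2)"
    using card_maps_contract_edge[OF G e[unfolded ab], of "{1..2::nat}" "(=)"]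
    by (simp add: locally_constant_def ab)
  then show ?thesis
    by (simp add: card_locally_constant G is_graph_contract_edge)
qed

text \<open>
  Removing an edge removes a condition, so it can only increase the number of locally constant
  maps.
\<close>

lemma cc_le_cc_delete_edge:
  assumes G: "is_graph G"
  shows "cc G \<le> cc (delete_edge G e)"
proof -
  have "locally_constant G 2 \<subseteq> locally_constant (delete_edge G e) 2"
    by (auto simp: locally_constant_def delete_edge_def)
  moreover have "finite (locally_constant (delete_edge G e) 2)"
    using finite_maps_interval[OF is_graph_delete_edge[OF G], of e 2]
    by (auto simp: locally_constant_def intro: finite_subset)
  ultimately have "(2::nat) ^ cc G \<le> 2 ^ cc (delete_edge G e)"
    using card_mono card_locally_constant G is_graph_delete_edge by metis
  then show ?thesis
    by simp
qed

theorem proposition2p8: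
  fixes G :: "'a graph" and e :: "'a set"
  assumes "is_graph G" and "e \<in> edges G"
  shows "chromatic_poly G = chromatic_poly (delete_edge G e) - chromatic_poly (contract_edge G e)
    \<and> lambda_chr G =
        (if bridge G e then - lambda_chr (contract_edge G e)
         else lambda_chr (delete_edge G e) - lambda_chr (contract_edge G e))"
proof
  note D = is_graph_delete_edge[OF assms(1), of e]
  note C = is_graph_contract_edge[OF assms(1), of e]
  show P: "chromatic_poly G = chromatic_poly (delete_edge G e) - chromatic_poly (contract_edge G e)"
    by (rule chromatic_poly_deletion_contraction[OF assms])
  have lambda: "lambda_chr G = coeff (chromatic_poly (delete_edge G e)) (cc G) - lambda_chr (contract_edge G e)"
    by (simp add: lambda_chr_eq_coeff assms(1) C P cc_contract_edge[OF assms])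
  show "lambda_chr G =
        (if bridge G e then - lambda_chr (contract_edge G e)
         else lambda_chr (delete_edge G e) - lambda_chr (contract_edge G e))"
  proof (cases "bridge G e")
    case True
    then show ?thesis
      using lambda coeff_chromatic_poly_below[OF D] by (simp add: bridge_def)
  next
    case False
    then have "cc (delete_edge G e) = cc G"
      using cc_le_cc_delete_edge[OF assms(1), of e] by (simp add: bridge_def)
    then show ?thesis
      using lambda False by (simp add: lambda_chr_eq_coeff[OF D])
  qed
qed

end
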